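(* Every quasi-multiplicative function $\Phi:\mathbb{F}\to\mathcal{L}(\mathcal{H})$ is the central extension of its restriction to $S_1$.
   Context: $\mathcal{H}$ is a Hilbert space, $\mathcal{L}(\mathcal{H})$ its bounded operators. $\mathbb{F}$ is the free group with finitely many generators $a_1,\dots,a_m$; $\mathcal{A}=\{a_1,\dots,a_m\}$; $e$ is the unit; words are written in reduced form over $\mathcal{A}\cup\mathcal{A}^{-1}$, $|s|$ is the reduced length of $s$, and $S_n=\{s\in\mathbb{F}:|s|\le n\}$. A function $\Phi:\mathbb{F}\to\mathcal{L}(\mathcal{H})$ is quasi-multiplicative if $\Phi(e)=I_{\mathcal{H}}$, $\|\Phi(s)\|\le1$ and $\Phi(s^{-1})=\Phi(s)^*$ for all $s$, and $\Phi(st)=\Phi(s)\Phi(t)$ whenever $|st|=|s|+|t|$. (Such functions are known to be positive definite, by a theorem of Bożejko.) For $\Sigma=\Sigma^{-1}\subset\mathbb{F}$, a function $\phi:\Sigma\to\mathcal{L}(\mathcal{H})$ is positive definite if for all $s_1,\dots,s_k\in\mathbb{F}$ with $s_i^{-1}s_j\in\Sigma$ for all $i,j$, the operator matrix $[\phi(s_i^{-1}s_j)]_{i,j=1}^k$ is positive semidefinite. For finite $S\subset\mathbb{F}$ with $s^{-1}t\in\Sigma$ for all $s,t\in S$, $A(\phi;S)=[\phi(s^{-1}t)]_{s,t\in S}$. $\mathrm{CB}(s,t)$ denotes the longest common initial segment of the reduced words $s,t$. A total order $\preceq$ on $\mathbb{F}$ is called lexicographic if $s_1\preceq s_2$ whenever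 either $|s_1|<|s_2|$, or $|s_1|=|s_2|$ and, with $t=\mathrm{CB}(s_1,s_2)$ and $b_i$ the first letter of $t^{-1}s_i$, one has $b_1\preceq b_2$. Given such an order, $\hat{\mathbb{F}}$ is the set of classes $\hat s=\{s,s^{-1}\}$, ordered by $\hat s\preceq\hat t$ iff $\min\{s,s^{-1}\}\preceq\min\{t,t^{-1}\}$; $\prec$ means $\preceq$ and $\ne$; $\mu^-$ is the predecessor of $\mu$. Put $\Sigma_\mu=\bigcup_{\mu'\preceq\mu}\mu'\subset\mathbb{F}$; thus $S_n=\Sigma_{\nu_n}$ where $\nu_n$ is the last class of words of length $n$. $\Gamma_\mu$ is the graph with vertex set $\mathbb{F}$ in which distinct $s,t$ are adjacent iff $\widehat{s^{-1}t}\preceq\mu$. Realizations: for a positive semidefinite block operator matrix $A=(A_{ij})_{i,j\in I}$ with entries in $\mathcal{L}(\mathcal{H})$, $\mathcal{R}(A)$ is the (essentially unique) Hilbert space with operators $\omega_i:\mathcal{H}\to\mathcal{R}(A)$ (isometries if $A_{ii}=I$) such that $A_{ij}=\omega_i^*\omega_j$ and the ranges $\omega_i\mathcal{H}$ span a dense subspace; it is $\{0\}$ if $I=\emptyset$. For $J\subset I$, $\mathcal{R}(A|J)$ (with $A|J$ the submatrix with rows and columns in $J$) is identified with the closed span of $\omega_i\mathcal{H}$, $i\in J$, in $\mathcal{R}(A)$. Central extension: for $\mu\neq\{e\}$ write $\mu=\{s_\mu,s_\mu^{-1}\}$ with $s_\mu\preceq s_\mu^{-1}$, and let $C_\mu$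 be the (unique, finite) maximal clique of $\Gamma_\mu$ containing $e$ and $s_\mu$. For a positive definite $\psi$ on $\Sigma_{\mu^-}$ set $\boldsymbol{D}(\psi)=\mathcal{R}(A(\psi;C_\mu\setminus\{s_\mu\}))\ominus\mathcal{R}(A(\psi;C_\mu\setminus\{e,s_\mu\}))$ and $\boldsymbol{R}(\psi)=\mathcal{R}(A(\psi;C_\mu\setminus\{e\}))\ominus\mathcal{R}(A(\psi;C_\mu\setminus\{e,s_\mu\}))$. If $\Phi$ is positive definite on $\mathbb{F}$, then for $\psi=\Phi|\Sigma_{\mu^-}$ both are subspaces of $\mathcal{R}(A(\Phi;C_\mu))$ and $\gamma_\mu(\Phi)=P_{\boldsymbol{R}(\psi)}|_{\boldsymbol{D}(\psi)}$. Positive definite extensions $\Phi$ to $\mathbb{F}$ of a positive definite $\phi:S_n\to\mathcal{L}(\mathcal{H})$ with $\phi(e)=I_{\mathcal{H}}$ correspond bijectively to sequences of contractions $(\gamma_\mu)_{\nu_n\prec\mu}$, $\gamma_\mu:\boldsymbol{D}(\Phi|\Sigma_{\mu^-})\to\boldsymbol{R}(\Phi|\Sigma_{\mu^-})$, via $\gamma_\mu=\gamma_\mu(\Phi)$. The central extension of $\phi$ is the one with $\gamma_\mu=0$ for all $\mu$ with $\nu_n\prec\mu$; it does not depend on the choice of the lexicographic order. *)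

theory Defs
  imports "HOL-Analysis.Analysis" "HOL-Library.Sublist"
begin

section \<open>Complex Hilbert spaces\<close>

text \<open>The inner product is linear in the first argument.  The real scalar multiplication and the
  norm inherited from \<^class>\<open>banach\<close> are tied to the complex structure by the axioms.\<close>

class chilbert_space = banach +
  fixes scaleC :: "complex \<Rightarrow> 'a \<Rightarrow> 'a" (infixr "*\<^sub>C" 75)
    and cinner :: "'a \<Rightarrow> 'a \<Rightarrow> complex"
  assumes scaleC_add_right: "c *\<^sub>C (x + y) = c *\<^sub>C x + c *\<^sub>C y"
    and scaleC_add_left: "(c + d) *\<^sub>C x = c *\<^sub>C x + d *\<^sub>C x"
    and scaleC_scaleC: "c *\<^sub>C (d *\<^sub>C x) = (c * d) *\<^sub>C x"
    and scaleR_scaleC: "scaleR a x = complex_of_real a *\<^sub>C x"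
    and cinner_commute: "cinner x y = cnj (cinner y x)"
    and cinner_add_left: "cinner (x + y) z = cinner x z + cinner y z"
    and cinner_scaleC_left: "cinner (c *\<^sub>C x) y = c * cinner x y"
    and cinner_ge_zero: "0 \<le> Re (cinner x x)"
    and norm_eq_sqrt_cinner: "norm x = sqrt (Re (cinner x x))"

global_interpretation complex_vector: vector_space "scaleC :: complex \<Rightarrow> 'a \<Rightarrow> 'a::chilbert_space"
proof
  show "1 *\<^sub>C x = x" for x :: 'a
    using scaleR_scaleC[of 1 x] by simp
qed (auto simp: scaleC_add_right scaleC_add_left scaleC_scaleC)

instantiation complex :: chilbert_space
begin

definition scaleC_complex :: "complex \<Rightarrow> complex \<Rightarrow> complex" where
  "scaleC_complex c x = c * x"

definition cinner_complex :: "complex \<Rightarrow> complex \<Rightarrow> complex" where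
  "cinner_complex x y = x * cnj y"

instance
  by standard
    (auto simp: scaleC_complex_def cinner_complex_def algebra_simps scaleR_conv_of_real
      cmod_def power2_eq_square)

end

definition clinear_ops :: "('h::chilbert_space \<Rightarrow>\<^sub>L 'k::chilbert_space) set" where
  "clinear_ops = {T. \<forall>c x. blinfun_apply T (c *\<^sub>C x) = c *\<^sub>C blinfun_apply T x}"

definition is_adjoint :: "('h::chilbert_space \<Rightarrow>\<^sub>L 'h) \<Rightarrow> ('h \<Rightarrow>\<^sub>L 'h) \<Rightarrow> bool" where
  "is_adjoint S T \<longleftrightarrow> (\<forall>x y. cinner (blinfun_apply T x) y = cinner x (blinfun_apply S y))"

definition orth_diff :: "'k::chilbert_space set \<Rightarrow> 'k set \<Rightarrow> 'k set" (infixl "\<ominus>" 65) where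
  "M \<ominus> N = {x \<in> M. \<forall>y\<in>N. cinner x y = 0}"

definition orth_proj :: "'k::chilbert_space set \<Rightarrow> 'k \<Rightarrow> 'k" where
  "orth_proj M x = (THE y. y \<in> M \<and> (\<forall>z\<in>M. cinner (x - y) z = 0))"


section \<open>Operator matrices and their realizations\<close>

definition psd :: "'i set \<Rightarrow> ('i \<Rightarrow> 'i \<Rightarrow> 'h::chilbert_space \<Rightarrow>\<^sub>L 'h) \<Rightarrow> bool" where
  "psd I A \<longleftrightarrow> (\<forall>x. let q = (\<Sum>i\<in>I. \<Sum>j\<in>I. cinner (blinfun_apply (A i j) (x j)) (x i))
                     in Im q = 0 \<and> 0 \<le> Re q)"

text \<open>The condition on the inner products says that $A_{ij} = \omega_i^* \omega_j$.  The ambient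
  space \<^typ>\<open>'k\<close> may be larger than the realization: the space $\mathcal{R}(A|J)$ is
  \<open>realization_space \<omega> J\<close>, in which the ranges span a dense subspace by construction.\<close>

definition realization ::
  "'i set \<Rightarrow> ('i \<Rightarrow> 'i \<Rightarrow> 'h::chilbert_space \<Rightarrow>\<^sub>L 'h) \<Rightarrow> ('i \<Rightarrow> 'h \<Rightarrow>\<^sub>L 'k::chilbert_space) \<Rightarrow> bool" where
  "realization I A \<omega> \<longleftrightarrow>
     (\<forall>i\<in>I. \<omega> i \<in> clinear_ops) \<and>
     (\<forall>i\<in>I. \<forall>j\<in>I. \<forall>x y. cinner (blinfun_apply (A i j) x) y
        = cinner (blinfun_apply (\<omega> j) x) (blinfun_apply (\<omega> i) y))"

definition realization_space :: "('i \<Rightarrow> 'h::chilbert_space \<Rightarrow>\<^sub>L 'k::chilbert_space) \<Rightarrow> 'i set \<Rightarrow> 'k set" where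
  "realization_space \<omega> J = closure (complex_vector.span (\<Union>i\<in>J. range (blinfun_apply (\<omega> i))))"


section \<open>The free group\<close>

text \<open>The generators are the elements of a finite type \<^typ>\<open>'a\<close>; the letter \<open>(a, True)\<close> stands for
  the generator $a$ and \<open>(a, False)\<close> for $a^{-1}$.\<close>

type_synonym 'a letter = "'a \<times> bool"

definition linv :: "'a letter \<Rightarrow> 'a letter" where
  "linv x = (fst x, \<not> snd x)"

definition reduced :: "'a letter list \<Rightarrow> bool" where
  "reduced w \<longleftrightarrow> successively (\<lambda>x y. y \<noteq> linv x) w"

typedef 'a fgroup = "{w :: 'a letter list. reduced w}" morphisms word Abs_fgroup
  by (rule exI[of _ "[]"]) (simp add: reduced_def)

setup_lifting type_definition_fgroup

fun push :: "'a letter \<Rightarrow> 'a letter list \<Rightarrow> 'a letter list" where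
  "push x [] = [x]"
| "push x (y # w) = (if y = linv x then w else x # y # w)"

lemma linv_linv [simp]: "linv (linv x) = x"
  by (simp add: linv_def)

lemma reduced_Nil [simp]: "reduced []"
  by (simp add: reduced_def)

lemma reduced_Cons: "reduced (x # w) \<longleftrightarrow> reduced w \<and> (w = [] \<or> hd w \<noteq> linv x)"
  by (cases w) (auto simp: reduced_def)

lemma reduced_push: "reduced w \<Longrightarrow> reduced (push x w)"
  by (cases w) (auto simp: reduced_Cons)

lemma reduced_foldr_push: "reduced w \<Longrightarrow> reduced (foldr push u w)"
  by (induction u) (auto simp: reduced_push)

lemma push_cancel: "reduced w \<Longrightarrow> push x (push (linv x) w) = w"
  by (cases w; cases "tl w") (auto simp: reduced_Cons)

lemma foldr_push_Nil: "reduced u \<Longrightarrow> foldr push u [] = u"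
proof (induction u)
  case (Cons x u)
  then show ?case by (cases u) (auto simp: reduced_Cons)
qed simp

lemma foldr_push_push: "reduced w \<Longrightarrow> foldr push (push x u) w = push x (foldr push u w)"
  by (cases u) (auto simp: push_cancel reduced_foldr_push)

lemma foldr_push_assoc:
  "reduced w \<Longrightarrow> foldr push (foldr push u v) w = foldr push u (foldr push v w)"
  by (induction u) (auto simp: foldr_push_push)

lemma reduced_rev_linv: "reduced w \<Longrightarrow> reduced (rev (map linv w))"
  unfolding reduced_def successively_rev successively_map
  by (erule successively_mono) (metis linv_linv)

lemma foldr_push_inverse: "foldr push (rev (map linv u)) u = []"
  by (induction u) auto

instantiation fgroup :: (type) "{monoid_mult, inverse}"
begin

lift_definition one_fgroup :: "'a fgroup" is "[]" by simp

lift_definition times_fgroup :: "'a fgroup \<Rightarrow> 'a fgroup \<Rightarrow> 'a fgroup" is "\<lambda>u v. foldr push u v"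
  by (rule reduced_foldr_push)

lift_definition inverse_fgroup :: "'a fgroup \<Rightarrow> 'a fgroup" is "\<lambda>w. rev (map linv w)"
  by (rule reduced_rev_linv)

definition divide_fgroup :: "'a fgroup \<Rightarrow> 'a fgroup \<Rightarrow> 'a fgroup" where
  "divide_fgroup s t = s * inverse t"

instance
  by standard (transfer; simp add: foldr_push_assoc foldr_push_Nil)+

end

lemma fgroup_left_inverse: "inverse s * s = (1 :: 'a fgroup)"
  by transfer (rule foldr_push_inverse)

definition wlen :: "'a fgroup \<Rightarrow> nat" where
  "wlen s = length (word s)"

definition word_ball :: "nat \<Rightarrow> 'a fgroup set" where
  "word_ball n = {s. wlen s \<le> n}"

definition CB :: "'a fgroup \<Rightarrow> 'a fgroup \<Rightarrow> 'a fgroup" where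
  "CB s t = Abs_fgroup (longest_common_prefix (word s) (word t))"

definition first_letter :: "'a fgroup \<Rightarrow> 'a fgroup" where
  "first_letter s = Abs_fgroup [hd (word s)]"


section \<open>Lexicographic orders, classes, and the graphs\<close>

text \<open>Orders are given as relations, \<open>(s, t) \<in> r\<close> meaning $s \preceq t$.\<close>

definition lexicographic :: "'a fgroup rel \<Rightarrow> bool" where
  "lexicographic r \<longleftrightarrow> linear_order r \<and>
     (\<forall>s\<^sub>1 s\<^sub>2. wlen s\<^sub>1 < wlen s\<^sub>2 \<or>
        (wlen s\<^sub>1 = wlen s\<^sub>2 \<and> s\<^sub>1 \<noteq> s\<^sub>2 \<and>
          (first_letter (inverse (CB s\<^sub>1 s\<^sub>2) * s\<^sub>1), first_letter (inverse (CB s\<^sub>1 s\<^sub>2) * s\<^sub>2)) \<in> r)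
        \<longrightarrow> (s\<^sub>1, s\<^sub>2) \<in> r)"

definition hat :: "'a fgroup \<Rightarrow> 'a fgroup set" where
  "hat s = {s, inverse s}"

text \<open>\<open>class_min r \<mu>\<close> is also the element $s_\mu$.\<close>

definition class_min :: "'a fgroup rel \<Rightarrow> 'a fgroup set \<Rightarrow> 'a fgroup" where
  "class_min r \<mu> = (THE s. s \<in> \<mu> \<and> (\<forall>t\<in>\<mu>. (s, t) \<in> r))"

definition class_le :: "'a fgroup rel \<Rightarrow> 'a fgroup set \<Rightarrow> 'a fgroup set \<Rightarrow> bool" where
  "class_le r \<mu> \<nu> \<longleftrightarrow> (class_min r \<mu>, class_min r \<nu>) \<in> r"

definition class_less :: "'a fgroup rel \<Rightarrow> 'a fgroup set \<Rightarrow> 'a fgroup set \<Rightarrow> bool" where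
  "class_less r \<mu> \<nu> \<longleftrightarrow> class_le r \<mu> \<nu> \<and> \<mu> \<noteq> \<nu>"

definition last_class :: "'a fgroup rel \<Rightarrow> nat \<Rightarrow> 'a fgroup set" where
  "last_class r n = (THE \<nu>. \<nu> \<in> hat ` {s. wlen s = n} \<and> (\<forall>s. wlen s = n \<longrightarrow> class_le r (hat s) \<nu>))"

definition adjacent :: "'a fgroup rel \<Rightarrow> 'a fgroup set \<Rightarrow> 'a fgroup \<Rightarrow> 'a fgroup \<Rightarrow> bool" where
  "adjacent r \<mu> s t \<longleftrightarrow> s \<noteq> t \<and> class_le r (hat (inverse s * t)) \<mu>"

definition maximal_clique :: "'a fgroup rel \<Rightarrow> 'a fgroup set \<Rightarrow> 'a fgroup set \<Rightarrow> bool" where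
  "maximal_clique r \<mu> C \<longleftrightarrow> pairwise (adjacent r \<mu>) C \<and>
     (\<forall>C'. pairwise (adjacent r \<mu>) C' \<and> C \<subseteq> C' \<longrightarrow> C' = C)"

text \<open>For a lexicographic order and $\mu \neq \{e\}$ there is exactly one such maximal clique, so that
  no choice is involved.\<close>

definition clique_of :: "'a fgroup rel \<Rightarrow> 'a fgroup set \<Rightarrow> 'a fgroup set" where
  "clique_of r \<mu> = (SOME C. maximal_clique r \<mu> C \<and> {1, class_min r \<mu>} \<subseteq> C)"


section \<open>Positive definite and quasi-multiplicative functions, central extensions\<close>

definition toeplitz :: "('a fgroup \<Rightarrow> 'h::chilbert_space \<Rightarrow>\<^sub>L 'h) \<Rightarrow> 'a fgroup \<Rightarrow> 'a fgroup \<Rightarrow> 'h \<Rightarrow>\<^sub>L 'h" where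
  "toeplitz \<phi> s t = \<phi> (inverse s * t)"

text \<open>A function on a subset $\Sigma$ of the group is represented by a total function whose values
  outside $\Sigma$ are irrelevant.\<close>

definition positive_definite_on ::
  "'a fgroup set \<Rightarrow> ('a fgroup \<Rightarrow> 'h::chilbert_space \<Rightarrow>\<^sub>L 'h) \<Rightarrow> bool" where
  "positive_definite_on \<Sigma> \<phi> \<longleftrightarrow> (\<forall>s\<in>\<Sigma>. \<phi> s \<in> clinear_ops) \<and>
     (\<forall>ss. (\<forall>i<length ss. \<forall>j<length ss. inverse (ss ! i) * ss ! j \<in> \<Sigma>) \<longrightarrow>
        psd {..<length ss} (\<lambda>i j. toeplitz \<phi> (ss ! i) (ss ! j)))"

definition quasi_multiplicative :: "('a fgroup \<Rightarrow> 'h::chilbert_space \<Rightarrow>\<^sub>L 'h) \<Rightarrow> bool" where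
  "quasi_multiplicative \<Phi> \<longleftrightarrow>
     (\<forall>s. \<Phi> s \<in> clinear_ops) \<and>
     \<Phi> 1 = id_blinfun \<and>
     (\<forall>s. norm (\<Phi> s) \<le> 1) \<and>
     (\<forall>s. is_adjoint (\<Phi> (inverse s)) (\<Phi> s)) \<and>
     (\<forall>s t. wlen (s * t) = wlen s + wlen t \<longrightarrow> \<Phi> (s * t) = \<Phi> s o\<^sub>L \<Phi> t)"

text \<open>The spaces $\boldsymbol{D}(\psi)$ and $\boldsymbol{R}(\psi)$ for $\psi = \Phi|\Sigma_{\mu^-}$ are taken
  inside $\mathcal{R}(A(\Phi; C_\mu))$, with \<open>\<omega>\<close> a realization of $A(\Phi; C_\mu)$.\<close>

definition D_space :: "'a fgroup rel \<Rightarrow> 'a fgroup set \<Rightarrow>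
    ('a fgroup \<Rightarrow> 'h::chilbert_space \<Rightarrow>\<^sub>L 'k::chilbert_space) \<Rightarrow> 'k set" where
  "D_space r \<mu> \<omega> = (let C = clique_of r \<mu>; s = class_min r \<mu> in
     realization_space \<omega> (C - {s}) \<ominus> realization_space \<omega> (C - {1, s}))"

definition R_space :: "'a fgroup rel \<Rightarrow> 'a fgroup set \<Rightarrow>
    ('a fgroup \<Rightarrow> 'h::chilbert_space \<Rightarrow>\<^sub>L 'k::chilbert_space) \<Rightarrow> 'k set" where
  "R_space r \<mu> \<omega> = (let C = clique_of r \<mu>; s = class_min r \<mu> in
     realization_space \<omega> (C - {1}) \<ominus> realization_space \<omega> (C - {1, s}))"

definition gamma :: "'a fgroup rel \<Rightarrow> 'a fgroup set \<Rightarrow>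
    ('a fgroup \<Rightarrow> 'h::chilbert_space \<Rightarrow>\<^sub>L 'k::chilbert_space) \<Rightarrow> 'k \<Rightarrow> 'k" where
  "gamma r \<mu> \<omega> = restrict (orth_proj (R_space r \<mu> \<omega>)) (D_space r \<mu> \<omega>)"

text \<open>\<open>\<Phi>\<close> is the central extension of \<open>\<phi>\<close>, defined on the words of length at most \<open>n\<close>.  Since
  realizations are determined only up to unitary equivalence, the condition $\gamma_\mu(\Phi) = 0$ is
  imposed for every realization whose ambient space is the Hilbert space type \<^typ>\<open>'k\<close>.  It carries
  its full content when \<^typ>\<open>'k\<close> is large enough to contain a realization of each
  $A(\Phi; C_\mu)$, as is the case for the Hilbert sum of countably many copies of \<^typ>\<open>'h\<close>.\<close>

definition central_extension ::
  "'k::chilbert_space itself \<Rightarrow> 'a fgroup rel \<Rightarrow> nat \<Rightarrow>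
    ('a fgroup \<Rightarrow> 'h::chilbert_space \<Rightarrow>\<^sub>L 'h) \<Rightarrow> ('a fgroup \<Rightarrow> 'h \<Rightarrow>\<^sub>L 'h) \<Rightarrow> bool" where
  "central_extension (_ :: 'k itself) r n \<phi> \<Phi> \<longleftrightarrow>
     positive_definite_on (word_ball n) \<phi> \<and> \<phi> 1 = id_blinfun \<and>
     positive_definite_on UNIV \<Phi> \<and> (\<forall>s\<in>word_ball n. \<Phi> s = \<phi> s) \<and>
     (\<forall>\<mu> \<in> range hat. class_less r (last_class r n) \<mu> \<longrightarrow>
        (\<forall>\<omega> :: 'a fgroup \<Rightarrow> 'h \<Rightarrow>\<^sub>L 'k. realization (clique_of r \<mu>) (toeplitz \<Phi>) \<omega> \<longrightarrow>
           (\<forall>x \<in> D_space r \<mu> \<omega>. gamma r \<mu> \<omega> x = 0)))"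

end

theory Submission
  imports Defs
begin

text \<open>
  View the free group as its Cayley tree and let \<open>\<Phi>\<close> be quasi-multiplicative.  If \<open>t\<close> lies on the
  geodesic from \<open>s\<close> to \<open>u\<close>, then
  $\Phi(s^{-1}u) = \Phi(s^{-1}t)\Phi(t^{-1}u)$: the kernel $\Phi(s^{-1}u)$ is Markovian along the
  tree.  Both halves of the claim follow from this.

  Positive definiteness.  Any finite set of vertices lies in a ball around the unit, and a ball is
  built by adding its vertices in the order of increasing length.  Each new vertex is a leaf \<open>u\<close>,
  connected to the earlier vertices through its neighbour \<open>t\<close> only, so its row and column factor
  through \<open>t\<close> by the contraction $\Phi(t^{-1}u)$; adding such a leaf preserves positivity
  (\<open>psd_insert_leaf\<close>).

  Vanishing of the parameters.  Let \<open>\<mu>\<close> come after the last class of length 1, so that $s_\mu$ has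
  length at least 2, and let \<open>t\<close> be its first letter.  An element \<open>c\<close> of the maximal clique is at
  distance at most $|s_\mu|$ both from the unit and from $s_\mu$.  Therefore \<open>c\<close> is the unit or starts
  with \<open>t\<close>, as otherwise the path from \<open>c\<close> to $s_\mu$ would pass through the unit and be too long
  (\<open>clique_of_first_letter\<close>); and then \<open>t\<close> is at distance less than $|s_\mu|$ from every \<open>c\<close>, so that
  \<open>t\<close> is itself in the clique (\<open>first_letter_in_clique_of\<close>).  Thus \<open>t\<close> separates the unit from all
  other vertices of the clique, in particular from $s_\mu$.  By the Markov property the part of
  $\omega_e\mathcal{H}$ not explained by the vertices other than \<open>e\<close> and $s_\mu$, whose
  closure is $\boldsymbol{D}$, is orthogonal to $\omega_{s_\mu}\mathcal{H}$ and hence to $\boldsymbol{R}$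
  (\<open>screened_defect_orthogonal\<close>).
\<close>

section \<open>Inner products\<close>

interpretation cinner_left: additive "\<lambda>x. cinner x (y :: 'b::chilbert_space)" for y
  by standard (rule cinner_add_left)

lemma cinner_add_right: "cinner x (y + z) = cinner x y + cinner x (z :: 'b::chilbert_space)"
  by (metis cinner_add_left cinner_commute complex_cnj_add)

interpretation cinner_right: additive "\<lambda>y. cinner (x :: 'b::chilbert_space) y" for x
  by standard (rule cinner_add_right)

lemma cinner_scaleC_right: "cinner x (c *\<^sub>C y) = cnj c * cinner x (y :: 'b::chilbert_space)"
  by (metis cinner_commute cinner_scaleC_left complex_cnj_mult)

lemma Im_cinner_self [simp]: "Im (cinner x (x :: 'b::chilbert_space)) = 0"
  by (metis cinner_commute Reals_cnj_iff complex_is_Real_iff)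

lemma norm_squared_cinner: "(norm x)\<^sup>2 = Re (cinner x (x :: 'b::chilbert_space))"
  by (simp add: norm_eq_sqrt_cinner cinner_ge_zero)

lemma cinner_self_eq_0_iff: "cinner x x = 0 \<longleftrightarrow> x = (0 :: 'b::chilbert_space)"
  by (metis cinner_left.zero norm_squared_cinner norm_eq_zero power_zero_numeral
      zero_complex.sel(1) power2_eq_iff_nonneg order_refl norm_ge_zero)

lemma cinner_eq_0_commute: "cinner x y = 0 \<longleftrightarrow> cinner y (x :: 'b::chilbert_space) = 0"
  by (metis cinner_commute complex_cnj_zero_iff)

lemma norm_add_squared_orthogonal:
  fixes x y :: "'b::chilbert_space"
  assumes "cinner x y = 0"
  shows "(norm (x + y))\<^sup>2 = (norm x)\<^sup>2 + (norm y)\<^sup>2"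
  using assms cinner_eq_0_commute[of x y]
  by (simp add: norm_squared_cinner cinner_add_left cinner_add_right)

text \<open>By polarization, the inner product is a continuous expression in norms.\<close>

lemma closed_orthogonal: "closed {x :: 'b::chilbert_space. cinner x y = 0}"
proof -
  have polarization: "Re (cinner x z) = ((norm (x + z))\<^sup>2 - (norm (x - z))\<^sup>2) / 4" for x z :: 'b
  proof -
    have "Re (cinner z x) = Re (cinner x z)"
      by (subst cinner_commute) simp
    then show ?thesis
      by (simp add: norm_squared_cinner cinner_add_left cinner_add_right
          cinner_left.diff cinner_right.diff)
  qed
  have closed_Re: "closed {x. Re (cinner x z) = 0}" for z :: 'b
    unfolding polarization by (intro closed_Collect_eq continuous_intros) simp
  have "{x. cinner x y = 0} = {x. Re (cinner x y) = 0} \<inter> {x. Re (cinner x (\<i> *\<^sub>C y)) = 0}"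
    by (auto simp: cinner_scaleC_right complex_eq_iff)
  then show ?thesis
    using closed_Re by (simp add: closed_Int)
qed


section \<open>Operator matrices with entries factoring through a separating index\<close>

lemma psd_empty: "psd {} A"
  by (simp add: psd_def)

lemma psd_cong:
  assumes "\<And>i j. i \<in> I \<Longrightarrow> j \<in> I \<Longrightarrow> A i j = B i j"
  shows "psd I A \<longleftrightarrow> psd I B"
proof -
  have "(\<Sum>i\<in>I. \<Sum>j\<in>I. cinner (blinfun_apply (A i j) (x j)) (x i))
      = (\<Sum>i\<in>I. \<Sum>j\<in>I. cinner (blinfun_apply (B i j) (x j)) (x i))" for x
    using assms by (intro sum.cong) auto
  then show ?thesis by (simp add: psd_def)
qed

text \<open>Repeated indices may be merged by adding up the vectors that sit at the same index.\<close>

lemma psd_reindex: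
  fixes A :: "'i \<Rightarrow> 'i \<Rightarrow> 'h::chilbert_space \<Rightarrow>\<^sub>L 'h" and g :: "'j \<Rightarrow> 'i"
  assumes "psd T A" "finite T" "finite I" "g ` I \<subseteq> T"
  shows "psd I (\<lambda>i j. A (g i) (g j))"
  unfolding psd_def
proof
  fix x :: "'j \<Rightarrow> 'h"
  define X where "X t = sum x {i \<in> I. g i = t}" for t
  let ?q = "\<Sum>i\<in>I. \<Sum>j\<in>I. cinner (A (g i) (g j) (x j)) (x i)"
  have "(\<Sum>s\<in>T. \<Sum>t\<in>T. cinner (A s t (X t)) (X s))
      = (\<Sum>s\<in>T. \<Sum>t\<in>T. \<Sum>i | i \<in> I \<and> g i = s. \<Sum>j | j \<in> I \<and> g j = t. cinner (A (g i) (g j) (x j)) (x i))"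
    unfolding X_def blinfun.sum_right cinner_left.sum cinner_right.sum
    by (intro sum.cong refl) auto
  also have "\<dots> = (\<Sum>s\<in>T. \<Sum>i | i \<in> I \<and> g i = s. \<Sum>t\<in>T. \<Sum>j | j \<in> I \<and> g j = t. cinner (A (g i) (g j) (x j)) (x i))"
    by (rule sum.cong[OF refl], rule sum.swap)
  \<comment> \<open>The congruence rule would turn \<open>g i\<close> into \<open>s\<close> in the summand and so prevent the regrouping.\<close>
  also have "\<dots> = ?q"
    using assms by (simp add: sum.group cong del: sum.cong_simp)
  finally show "let q = ?q in Im q = 0 \<and> 0 \<le> Re q"
    using assms(1) unfolding psd_def Let_def by metis
qed

text \<open>Let \<open>u\<close> be a leaf attached at \<open>t\<close>: the entries linking \<open>u\<close> to \<open>S\<close> factor through \<open>t\<close> by a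
  contraction \<open>G\<close>.  Transporting the vector at \<open>u\<close> to \<open>t\<close> by \<open>G\<close> leaves a vector over \<open>S\<close> and lowers
  the value of the quadratic form by exactly $\|x_u\|^2 - \|G x_u\|^2 \ge 0$.\<close>

lemma psd_insert_leaf:
  fixes A :: "'i \<Rightarrow> 'i \<Rightarrow> 'h::chilbert_space \<Rightarrow>\<^sub>L 'h"
  assumes "psd S A" "finite S" "t \<in> S" "u \<notin> S"
    and hermitian: "\<And>i j x y. cinner (A i j x) y = cinner x (A j i y)"
    and diagonal: "A t t = id_blinfun" "A u u = id_blinfun"
    and contraction: "norm G \<le> 1"
    and factor: "\<And>s. s \<in> S \<Longrightarrow> A s u = A s t o\<^sub>L G"
  shows "psd (insert u S) A"
  unfolding psd_def
proof
  fix x :: "'i \<Rightarrow> 'h"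
  define g where "g = blinfun_apply G (x u)"
  define d where "d i = (if i = t then g else 0)" for i
  define Q where "Q y = (\<Sum>i\<in>S. \<Sum>j\<in>S. cinner (A i j (y j)) (y i))" for y
  let ?q = "\<Sum>i\<in>insert u S. \<Sum>j\<in>insert u S. cinner (A i j (x j)) (x i)"
  have column: "cinner (A i u (x u)) y = cinner (A i t g) y" if "i \<in> S" for i y
    using factor[OF that] by (simp add: g_def)
  have row: "cinner (A u j y) (x u) = cinner (A t j y) g" if "j \<in> S" for j y
    by (metis hermitian column[OF that] cinner_commute)
  have d_left: "cinner (A i j (d j)) y = (if j = t then cinner (A i t g) y else 0)" for i j y
    by (simp add: d_def cinner_left.zero)
  have d_right: "cinner y (d i) = (if i = t then cinner y g else 0)" for i y
    by (simp add: d_def cinner_right.zero)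
  have single_row: "(\<Sum>i\<in>S. \<Sum>j\<in>S. if i = t then f i j else 0) = (\<Sum>j\<in>S. f t j)"
    for f :: "'i \<Rightarrow> 'i \<Rightarrow> complex"
    using \<open>finite S\<close> \<open>t \<in> S\<close> by (subst sum.swap) simp
  have "Q (\<lambda>i. x i + d i) = Q x + (\<Sum>i\<in>S. cinner (A i t g) (x i))
      + (\<Sum>j\<in>S. cinner (A t j (x j)) g) + cinner g g"
    using \<open>finite S\<close> \<open>t \<in> S\<close>
    by (simp add: Q_def blinfun.add_right cinner_add_left cinner_add_right sum.distrib
        d_left d_right single_row diagonal)
  moreover have "?q = Q x + (\<Sum>i\<in>S. cinner (A i t g) (x i))
      + (\<Sum>j\<in>S. cinner (A t j (x j)) g) + cinner (x u) (x u)"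
    using \<open>finite S\<close> \<open>u \<notin> S\<close>
    by (simp add: Q_def sum.distrib column row diagonal)
  ultimately have "?q = Q (\<lambda>i. x i + d i) + (cinner (x u) (x u) - cinner g g)"
    by simp
  moreover have "(norm g)\<^sup>2 \<le> (norm (x u))\<^sup>2"
    unfolding g_def using norm_blinfun[of G "x u"] mult_right_mono[OF contraction, of "norm (x u)"]
    by (intro power_mono) auto
  moreover have "Im (Q (\<lambda>i. x i + d i)) = 0 \<and> 0 \<le> Re (Q (\<lambda>i. x i + d i))"
    using \<open>psd S A\<close> unfolding psd_def Let_def Q_def by fast
  ultimately show "let q = ?q in Im q = 0 \<and> 0 \<le> Re q"
    by (simp add: norm_squared_cinner)
qed

lemma span_insert_range:
  fixes \<omega> :: "'i \<Rightarrow> 'h::chilbert_space \<Rightarrow>\<^sub>L 'k::chilbert_space"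
  assumes "\<omega> p \<in> clinear_ops"
  shows "complex_vector.span (\<Union>i\<in>insert p J. range (\<omega> i))
    = {\<omega> p h + c | h c. c \<in> complex_vector.span (\<Union>i\<in>J. range (\<omega> i))}"
proof -
  have "complex_vector.subspace (range (\<omega> p))"
    unfolding complex_vector.subspace_def
  proof (intro conjI ballI allI)
    show "0 \<in> range (\<omega> p)"
      by (metis blinfun.zero_right rangeI)
    show "x + y \<in> range (\<omega> p)" if "x \<in> range (\<omega> p)" "y \<in> range (\<omega> p)" for x y
      using that by (auto simp flip: blinfun.add_right)
    show "c *\<^sub>C x \<in> range (\<omega> p)" if x: "x \<in> range (\<omega> p)" for c x
    proof -
      obtain h where "x = \<omega> p h"
        using x by blast
      then have "c *\<^sub>C x = \<omega> p (c *\<^sub>C h)"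
        using assms by (simp add: clinear_ops_def)
      then show ?thesis
        by simp
    qed
  qed
  then have span_p: "complex_vector.span (range (\<omega> p)) = range (\<omega> p)"
    by (simp only: complex_vector.span_eq_iff)
  show ?thesis
    by (simp only: UN_insert complex_vector.span_Un span_p) blast
qed

text \<open>The vector \<open>x\<close> is a limit of vectors $\omega_p h + c$ with \<open>c\<close> in the span over the indices other
  than \<open>p\<close> and \<open>q\<close>.  Since \<open>t\<close> separates \<open>p\<close> from the other indices, $\omega_p h - \omega_t G h$ is
  orthogonal to all of them; and as \<open>x\<close> is orthogonal to $c + \omega_t G h$, Pythagoras shows that
  $\omega_p h - \omega_t G h$ approximates \<open>x\<close> at least as well as $\omega_p h + c$.  So \<open>x\<close> is a
  limit of vectors orthogonal to $\omega_q$ as well.\<close>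

lemma screened_defect_orthogonal:
  fixes \<omega> :: "'i \<Rightarrow> 'h::chilbert_space \<Rightarrow>\<^sub>L 'k::chilbert_space"
  assumes "realization I A \<omega>"
    and indices: "p \<in> I" "q \<in> I" "t \<in> I" "p \<noteq> q" "t \<noteq> p" "t \<noteq> q"
    and screen: "\<And>v. v \<in> I - {p} \<Longrightarrow> A v p = A v t o\<^sub>L G"
    and x: "x \<in> realization_space \<omega> (I - {q}) \<ominus> realization_space \<omega> (I - {p, q})"
    and z: "z \<in> realization_space \<omega> (I - {p})"
  shows "cinner x z = 0"
proof -
  let ?N = "complex_vector.span (\<Union>i\<in>I - {p, q}. range (blinfun_apply (\<omega> i)))"
  define a where "a h = \<omega> p h - \<omega> t (G h)" for h
  have a_orth: "cinner (a h) (\<omega> v k) = 0" if "v \<in> I - {p}" for h v k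
    using assms(1) that indices screen[OF that]
    by (simp add: realization_def a_def cinner_left.diff flip: blinfun_apply_blinfun_compose)
      (metis blinfun_apply_blinfun_compose)
  have x_orth: "cinner x c = 0" if "c \<in> ?N" for c
    using x that closure_subset unfolding orth_diff_def realization_space_def by blast
  have subspace_orth: "complex_vector.subspace {c. cinner y c = 0}" for y :: 'k
    by (auto simp: complex_vector.subspace_def cinner_add_right cinner_scaleC_right cinner_right.zero)
  have a_orth_N: "cinner (a h) c = 0" if "c \<in> ?N" for h c
  proof -
    have "(\<Union>i\<in>I - {p, q}. range (\<omega> i)) \<subseteq> {c. cinner (a h) c = 0}"
      using a_orth by blast
    then show ?thesis
      using that complex_vector.span_minimal[OF _ subspace_orth] by blast
  qed
  have x_approx: "x \<in> closure (range a)"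
    unfolding closure_approachable
  proof (intro allI impI)
    fix \<epsilon> :: real
    assume "\<epsilon> > 0"
    have "I - {q} = insert p (I - {p, q})"
      using indices by blast
    with x have "x \<in> closure {\<omega> p h + c | h c. c \<in> ?N}"
      using span_insert_range[of \<omega> p "I - {p, q}"] assms(1) indices
      by (simp add: realization_def orth_diff_def realization_space_def)
    then obtain h c where c: "c \<in> ?N" and near: "dist (\<omega> p h + c) x < \<epsilon>"
      unfolding closure_approachable using \<open>\<epsilon> > 0\<close> by blast
    define c' where "c' = c + \<omega> t (G h)"
    have "c' \<in> ?N"
      unfolding c'_def
    proof (rule complex_vector.span_add[OF c])
      show "\<omega> t (G h) \<in> ?N"
        using indices by (intro complex_vector.span_base) auto
    qed
    then have "cinner (a h - x) c' = 0"
      by (simp add: cinner_left.diff x_orth a_orth_N)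
    then have "(norm (a h - x))\<^sup>2 \<le> (norm (a h - x + c'))\<^sup>2"
      by (simp add: norm_add_squared_orthogonal)
    then have "norm (a h - x) \<le> norm (a h - x + c')"
      by simp
    also have "a h - x + c' = \<omega> p h + c - x"
      by (simp add: a_def c'_def)
    finally show "\<exists>y\<in>range a. dist y x < \<epsilon>"
      using near by (auto simp: dist_norm intro: le_less_trans)
  qed
  have x_orth_range: "cinner x (\<omega> v k) = 0" if "v \<in> I - {p}" for v k
    using x_approx closure_minimal[OF _ closed_orthogonal[of "\<omega> v k"], of "range a"] a_orth[OF that]
    by blast
  have "complex_vector.span (\<Union>i\<in>I - {p}. range (\<omega> i)) \<subseteq> {c. cinner x c = 0}"
    using x_orth_range by (intro complex_vector.span_minimal subspace_orth) auto
  then have "realization_space \<omega> (I - {p}) \<subseteq> {c. cinner c x = 0}"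
    unfolding realization_space_def
    by (intro closure_minimal closed_orthogonal) (auto simp: cinner_eq_0_commute)
  with z show ?thesis
    by (auto simp: cinner_eq_0_commute)
qed

lemma zero_in_realization_space: "0 \<in> realization_space \<omega> J"
  unfolding realization_space_def
  using closure_subset complex_vector.span_zero by blast

lemma orth_proj_eq_0:
  assumes "0 \<in> M" "\<And>z. z \<in> M \<Longrightarrow> cinner x z = 0"
  shows "orth_proj M x = (0 :: 'k::chilbert_space)"
  unfolding orth_proj_def
proof (rule the_equality)
  show "0 \<in> M \<and> (\<forall>z\<in>M. cinner (x - 0) z = 0)"
    using assms by simp
  fix y
  assume y: "y \<in> M \<and> (\<forall>z\<in>M. cinner (x - y) z = 0)"
  then have "cinner y y = 0"
    using assms(2)[of y] by (simp add: cinner_left.diff)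
  then show "y = 0"
    by (simp add: cinner_self_eq_0_iff)
qed


section \<open>Reduced words\<close>

interpretation fgroup: group "(*)" "1 :: 'a fgroup" inverse
  by standard (simp_all add: fgroup_left_inverse mult.assoc)

lemma reduced_word [simp]: "reduced (word s)"
  using word by auto

lemma word_one [simp]: "word 1 = []"
  by transfer simp

lemma word_eq_Nil_iff [simp]: "word s = [] \<longleftrightarrow> s = 1"
  by transfer simp

lemma wlen_one [simp]: "wlen 1 = 0"
  by (simp add: wlen_def)

lemma wlen_eq_0_iff [simp]: "wlen s = 0 \<longleftrightarrow> s = 1"
  by (simp add: wlen_def)

lemma word_inverse: "word (inverse s) = rev (map linv (word s))"
  by transfer simp

lemma wlen_inverse [simp]: "wlen (inverse s) = wlen s"
  by (simp add: wlen_def word_inverse)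

lemma reduced_append:
  "reduced (u @ v) \<longleftrightarrow> reduced u \<and> reduced v \<and> (u = [] \<or> v = [] \<or> hd v \<noteq> linv (last u))"
  by (auto simp: reduced_def successively_append_iff)

lemma foldr_push_append: "reduced (u @ v) \<Longrightarrow> foldr push u v = u @ v"
proof (induction u)
  case (Cons x u)
  then show ?case by (cases "u @ v") (auto simp: reduced_Cons)
qed simp

lemma word_times: "reduced (word s @ word t) \<Longrightarrow> word (s * t) = word s @ word t"
  by transfer (rule foldr_push_append)

lemma finite_word_ball: "finite (word_ball n :: 'a::finite fgroup set)"
proof -
  have "finite {w :: 'a letter list. set w \<subseteq> UNIV \<and> length w \<le> n}"
    by (rule finite_lists_length_le) simp
  then have "finite (word ` (word_ball n :: 'a fgroup set))"
    by (rule finite_subset[rotated]) (auto simp: word_ball_def wlen_def)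
  then show ?thesis
    by (rule finite_imageD) (meson inj_onI word_inject)
qed

definition letter :: "'a letter \<Rightarrow> 'a fgroup" where
  "letter x = Abs_fgroup [x]"

lemma word_letter [simp]: "word (letter x) = [x]"
  by (simp add: letter_def Abs_fgroup_inverse reduced_def)

lemma wlen_letter [simp]: "wlen (letter x) = 1"
  by (simp add: wlen_def)

lemma word_snoc_times: "word u = word v @ [x] \<Longrightarrow> u = v * letter x"
  by (metis reduced_word word_inject word_letter word_times)

lemma word_Cons_times: "word u = x # word v \<Longrightarrow> u = letter x * v"
  by (metis append_Cons append_Nil reduced_word word_inject word_letter word_times)

lemma word_ConsE:
  assumes "word s = x # w"
  obtains r where "word r = w" "s = letter x * r" "wlen s = Suc (wlen r)"
proof -
  have "reduced w"
    using reduced_word[of s] assms by (simp add: reduced_Cons)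
  then have "word (Abs_fgroup w) = w"
    by (simp add: Abs_fgroup_inverse)
  then show thesis
    using that[of "Abs_fgroup w"] assms word_Cons_times by (metis length_Cons wlen_def)
qed

lemma word_snocE:
  assumes "s \<noteq> 1"
  obtains r x where "word s = word r @ [x]"
proof -
  obtain w x where w: "word s = w @ [x]"
    using assms by (metis rev_exhaust word_eq_Nil_iff)
  then have "reduced w"
    using reduced_word[of s] by (simp add: reduced_append)
  then show thesis
    using that[of "Abs_fgroup w" x] w by (simp add: Abs_fgroup_inverse)
qed

text \<open>In the Cayley tree \<open>u\<close> is a neighbour of \<open>v\<close>, one step further from the origin.  The words
  lying behind \<open>u\<close> as seen from \<open>v\<close> extend \<open>u\<close>; so from every other \<open>s\<close> that is not longer than \<open>u\<close>, the
  vertex \<open>u\<close> is reached through \<open>v\<close>.\<close>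

lemma wlen_step_from:
  assumes u: "word u = word v @ [x]" and s: "s \<noteq> u" "wlen s \<le> wlen u"
  shows "wlen (inverse s * u) = Suc (wlen (inverse s * v))"
proof -
  have inverse_u: "inverse u = letter (linv x) * inverse v"
  proof (rule word_Cons_times)
    show "word (inverse u) = linv x # word (inverse v)"
      by (simp add: word_inverse u)
  qed
  have "reduced (word (letter (linv x)) @ word (inverse v * s))"
  proof (rule ccontr)
    assume "\<not> ?thesis"
    then obtain w where w: "word (inverse v * s) = x # w"
      by (cases "word (inverse v * s)") (use reduced_word[of "inverse v * s"] in \<open>auto simp: reduced_Cons\<close>)
    then obtain r where r: "word r = w" "inverse v * s = letter x * r"
      by (rule word_ConsE)
    have "s = v * (letter x * r)"
      by (metis r(2) fgroup.right_inverse mult.assoc mult_1)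
    then have "s = u * r"
      using word_snoc_times[OF u] by (simp add: mult.assoc)
    moreover have "reduced (word u @ word r)"
      using reduced_word[of u] reduced_word[of "inverse v * s"] u w r(1)
      by (auto simp: reduced_append reduced_Cons)
    ultimately have "wlen s = wlen u + wlen r"
      by (simp add: wlen_def word_times)
    with s \<open>s = u * r\<close> show False
      by simp
  qed
  then have "wlen (inverse u * s) = Suc (wlen (inverse v * s))"
    by (simp add: inverse_u mult.assoc wlen_def word_times)
  moreover have "wlen (inverse y * s) = wlen (inverse s * y)" for y
    by (metis fgroup.inverse_distrib_swap fgroup.inverse_inverse wlen_inverse)
  ultimately show ?thesis
    by simp
qed

text \<open>Words with different first letters leave the origin of the Cayley tree along different edges, so
  the geodesic between them passes through the origin.\<close>

lemma wlen_different_first_letters: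
  assumes "s \<noteq> 1" "t \<noteq> 1" "hd (word s) \<noteq> hd (word t)"
  shows "wlen (inverse s * t) = wlen s + wlen t"
proof -
  have "reduced (word (inverse s) @ word t)"
    using assms reduced_rev_linv[OF reduced_word[of s]]
    by (auto simp: reduced_append word_inverse last_rev hd_map)
  then show ?thesis
    by (simp add: wlen_def word_times word_inverse)
qed


section \<open>Quasi-multiplicative functions are positive definite\<close>

lemma quasi_multiplicative_one: "quasi_multiplicative \<Phi> \<Longrightarrow> \<Phi> 1 = id_blinfun"
  by (simp add: quasi_multiplicative_def)

lemma quasi_multiplicative_times:
  "quasi_multiplicative \<Phi> \<Longrightarrow> wlen (s * t) = wlen s + wlen t \<Longrightarrow> \<Phi> (s * t) = \<Phi> s o\<^sub>L \<Phi> t"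
  by (simp add: quasi_multiplicative_def)

lemma toeplitz_adjoint:
  assumes "quasi_multiplicative \<Phi>"
  shows "cinner (toeplitz \<Phi> s t x) y = cinner x (toeplitz \<Phi> t s y)"
proof -
  have "inverse t * s = inverse (inverse s * t)"
    by (simp add: fgroup.inverse_distrib_swap)
  then show ?thesis
    using assms by (simp add: toeplitz_def quasi_multiplicative_def is_adjoint_def)
qed

text \<open>A finite subtree containing the origin grows by adding its vertices in the order of increasing
  length, each new vertex being a leaf.\<close>

lemma psd_toeplitz_prefix_closed:
  fixes \<Phi> :: "'a fgroup \<Rightarrow> 'h::chilbert_space \<Rightarrow>\<^sub>L 'h"
  assumes \<Phi>: "quasi_multiplicative \<Phi>"
    and "finite S" "\<And>u v x. u \<in> S \<Longrightarrow> word u = word v @ [x] \<Longrightarrow> v \<in> S"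
  shows "psd S (toeplitz \<Phi>)"
  using assms(2,3)
proof (induction S rule: finite_ranking_induct[where f = wlen])
  case empty
  show ?case by (rule psd_empty)
next
  case (insert u S)
  show ?case
  proof (cases "u \<in> S")
    case True
    then show ?thesis
      using insert by (simp add: insert_absorb)
  next
    case False
    have "v \<in> S" if "w \<in> S" "word w = word v @ [x]" for v w x
    proof -
      have "wlen v < wlen w"
        using that by (simp add: wlen_def)
      then show ?thesis
        using insert.prems[of w v x] insert.hyps(2)[OF that(1)] that by auto
    qed
    then have psd_S: "psd S (toeplitz \<Phi>)"
      by (rule insert.IH)
    show ?thesis
    proof (cases "u = 1")
      case True
      then have "S = {}"
        using insert.hyps(2) False by force
      then show ?thesis
        using True \<Phi> by (simp add: psd_def toeplitz_def quasi_multiplicative_one cinner_ge_zero)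
    next
      case nontrivial: False
      then obtain v x where u: "word u = word v @ [x]"
        by (rule word_snocE)
      then have v: "v \<in> S"
        using insert.prems[of u v x] by auto
      have "toeplitz \<Phi> s u = toeplitz \<Phi> s v o\<^sub>L \<Phi> (letter x)" if "s \<in> S" for s
      proof -
        have "wlen (inverse s * u) = wlen (inverse s * v) + wlen (letter x)"
          using wlen_step_from[OF u] insert.hyps(2) that False by fastforce
        moreover have "inverse s * u = inverse s * v * letter x"
          using word_snoc_times[OF u] by (simp add: mult.assoc)
        ultimately show ?thesis
          unfolding toeplitz_def using quasi_multiplicative_times[OF \<Phi>] by metis
      qed
      moreover have "toeplitz \<Phi> s s = id_blinfun" for s
        using \<Phi> by (simp add: toeplitz_def fgroup_left_inverse quasi_multiplicative_one)
      moreover have "norm (\<Phi> (letter x)) \<le> 1"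
        using \<Phi> by (simp add: quasi_multiplicative_def)
      ultimately show ?thesis
        using psd_insert_leaf[OF psd_S insert.hyps(1) v False toeplitz_adjoint[OF \<Phi>]] by blast
    qed
  qed
qed

theorem quasi_multiplicative_positive_definite:
  fixes \<Phi> :: "'a::finite fgroup \<Rightarrow> 'h::chilbert_space \<Rightarrow>\<^sub>L 'h"
  assumes "quasi_multiplicative \<Phi>"
  shows "positive_definite_on UNIV \<Phi>"
  unfolding positive_definite_on_def
proof (intro conjI ballI allI impI)
  show "\<Phi> s \<in> clinear_ops" for s
    using assms by (simp add: quasi_multiplicative_def)
next
  fix ss :: "'a fgroup list"
  define n where "n = Max (insert 0 (wlen ` set ss))"
  have "set ss \<subseteq> word_ball n"
    unfolding n_def word_ball_def by auto
  then have subset: "(!) ss ` {..<length ss} \<subseteq> word_ball n"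
    using nth_mem by auto
  have psd_ball: "psd (word_ball n) (toeplitz \<Phi>)"
    by (rule psd_toeplitz_prefix_closed[OF assms finite_word_ball])
      (auto simp: word_ball_def wlen_def)
  show "psd {..<length ss} (\<lambda>i j. toeplitz \<Phi> (ss ! i) (ss ! j))"
    by (rule psd_reindex[OF psd_ball finite_word_ball finite_lessThan subset])
qed

lemma positive_definite_on_restrict:
  assumes "positive_definite_on UNIV \<Phi>"
  shows "positive_definite_on \<Sigma> (restrict \<Phi> \<Sigma>)"
  unfolding positive_definite_on_def
proof (intro conjI ballI allI impI)
  show "restrict \<Phi> \<Sigma> s \<in> clinear_ops" if "s \<in> \<Sigma>" for s
    using assms that by (simp add: positive_definite_on_def)
next
  fix ss
  assume "\<forall>i<length ss. \<forall>j<length ss. inverse (ss ! i) * ss ! j \<in> \<Sigma>"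
  then have "psd {..<length ss} (\<lambda>i j. toeplitz (restrict \<Phi> \<Sigma>) (ss ! i) (ss ! j))
      \<longleftrightarrow> psd {..<length ss} (\<lambda>i j. toeplitz \<Phi> (ss ! i) (ss ! j))"
    by (intro psd_cong) (simp add: toeplitz_def)
  then show "psd {..<length ss} (\<lambda>i j. toeplitz (restrict \<Phi> \<Sigma>) (ss ! i) (ss ! j))"
    using assms by (simp add: positive_definite_on_def)
qed


section \<open>Classes and cliques\<close>

lemma hat_inverse [simp]: "hat (inverse s) = hat s"
  by (auto simp: hat_def)

lemma class_min_eqI:
  assumes "antisym r" "s \<in> \<mu>" "\<And>t. t \<in> \<mu> \<Longrightarrow> (s, t) \<in> r"
  shows "class_min r \<mu> = s"
  unfolding class_min_def using assms by (intro the_equality) (auto dest: antisymD)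

context
  fixes r :: "'a::finite fgroup rel"
  assumes lex: "lexicographic r"
begin

lemma linear_order_lex: "linear_order r"
  using lex unfolding lexicographic_def by (rule conjunct1)

lemma order_refl_lex: "(s, s) \<in> r"
  using linear_order_lex by (auto simp: order_on_defs refl_on_def)

lemma order_antisym_lex: "antisym r"
  using linear_order_lex by (simp add: order_on_defs)

lemma order_trans_lex: "trans r"
  using linear_order_lex by (simp add: order_on_defs)

lemma order_total_lex: "(s, t) \<in> r \<or> (t, s) \<in> r"
  using linear_order_lex order_refl_lex[of s] by (cases "s = t") (auto simp: order_on_defs total_on_def)

lemma order_shorter: "wlen s < wlen t \<Longrightarrow> (s, t) \<in> r"
  using lex unfolding lexicographic_def by blast

lemma order_wlen: "(s, t) \<in> r \<Longrightarrow> wlen s \<le> wlen t"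
  using order_shorter[of t s] order_antisym_lex by (metis antisymD linorder_not_le order.refl)

lemma class_min_hat: "class_min r (hat s) = s \<or> class_min r (hat s) = inverse s"
  using order_total_lex[of s "inverse s"]
proof
  assume "(s, inverse s) \<in> r"
  then have "class_min r (hat s) = s"
    using order_antisym_lex order_refl_lex by (intro class_min_eqI) (auto simp: hat_def)
  then show ?thesis ..
next
  assume "(inverse s, s) \<in> r"
  then have "class_min r (hat s) = inverse s"
    using order_antisym_lex order_refl_lex by (intro class_min_eqI) (auto simp: hat_def)
  then show ?thesis ..
qed

lemma hat_class_min:
  assumes "\<mu> \<in> range hat"
  shows "hat (class_min r \<mu>) = \<mu>"
proof -
  obtain s where "\<mu> = hat s"
    using assms by blast
  then show ?thesis
    using class_min_hat[of s] by (elim disjE) simp_all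
qed

lemma wlen_class_min [simp]: "wlen (class_min r (hat s)) = wlen s"
  using class_min_hat[of s] by (elim disjE) simp_all

lemma class_le_refl: "class_le r \<mu> \<mu>"
  by (simp add: class_le_def order_refl_lex)

lemma class_le_antisym:
  "class_le r \<mu> \<nu> \<Longrightarrow> class_le r \<nu> \<mu> \<Longrightarrow> \<mu> \<in> range hat \<Longrightarrow> \<nu> \<in> range hat \<Longrightarrow> \<mu> = \<nu>"
  unfolding class_le_def
  using hat_class_min[of \<mu>] hat_class_min[of \<nu>] antisymD[OF order_antisym_lex] by metis

lemma class_le_shorter: "wlen g < wlen (class_min r \<mu>) \<Longrightarrow> class_le r (hat g) \<mu>"
  unfolding class_le_def by (rule order_shorter) simp

lemma class_le_wlen: "class_le r (hat g) \<mu> \<Longrightarrow> wlen g \<le> wlen (class_min r \<mu>)"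
  unfolding class_le_def using order_wlen wlen_class_min by metis

lemma class_le_greatest:
  assumes "finite K" "K \<noteq> {}"
  shows "\<exists>\<nu>\<in>K. \<forall>\<mu>\<in>K. class_le r \<mu> \<nu>"
  using assms
proof (induction K rule: finite_ne_induct)
  case (singleton \<mu>)
  then show ?case by (simp add: class_le_refl)
next
  case (insert \<mu> K)
  then obtain \<nu> where \<nu>: "\<nu> \<in> K" "\<forall>\<mu>\<in>K. class_le r \<mu> \<nu>"
    by blast
  show ?case
  proof (cases "class_le r \<mu> \<nu>")
    case True
    then show ?thesis
      using \<nu> by blast
  next
    case False
    then have "class_le r \<nu> \<mu>"
      using order_total_lex unfolding class_le_def by blast
    then have "\<forall>\<mu>'\<in>K. class_le r \<mu>' \<mu>"
      using \<nu>(2) transD[OF order_trans_lex] unfolding class_le_def by blast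
    then show ?thesis
      using class_le_refl by blast
  qed
qed

lemma last_class:
  fixes s\<^sub>0 :: "'a fgroup"
  assumes "wlen s\<^sub>0 = n"
  shows "last_class r n \<in> hat ` {s. wlen s = n} \<and> (\<forall>s. wlen s = n \<longrightarrow> class_le r (hat s) (last_class r n))"
proof -
  let ?K = "hat ` {s :: 'a fgroup. wlen s = n}"
  have "finite {s :: 'a fgroup. wlen s = n}"
    by (rule finite_subset[OF _ finite_word_ball[of n]]) (auto simp: word_ball_def)
  then obtain \<nu> where \<nu>: "\<nu> \<in> ?K" "\<forall>\<mu>\<in>?K. class_le r \<mu> \<nu>"
    using class_le_greatest[of ?K] assms by blast
  show ?thesis
    unfolding last_class_def
  proof (rule theI)
    show "\<nu> \<in> ?K \<and> (\<forall>s. wlen s = n \<longrightarrow> class_le r (hat s) \<nu>)"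
      using \<nu> by blast
    show "\<nu>' = \<nu>" if "\<nu>' \<in> ?K \<and> (\<forall>s. wlen s = n \<longrightarrow> class_le r (hat s) \<nu>')" for \<nu>'
    proof (rule class_le_antisym)
      show "class_le r \<nu>' \<nu>"
        using that \<nu>(2) by blast
      show "class_le r \<nu> \<nu>'"
        using that \<nu>(1) by auto
      show "\<nu>' \<in> range hat" "\<nu> \<in> range hat"
        using that \<nu>(1) by auto
    qed
  qed
qed

lemma class_after_letters:
  assumes "\<mu> \<in> range hat" "class_less r (last_class r 1) \<mu>"
  shows "2 \<le> wlen (class_min r \<mu>)"
proof -
  let ?\<nu> = "last_class r 1"
  obtain l :: "'a fgroup" where "wlen l = 1"
    using wlen_letter by blast
  note last = last_class[OF this, THEN conjunct1] last_class[OF this, THEN conjunct2, rule_format]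
  obtain l where l: "wlen l = 1" "?\<nu> = hat l"
    using last(1) by auto
  obtain s where s: "\<mu> = hat s"
    using assms(1) by blast
  have "1 \<le> wlen s"
    using assms(2) l s class_le_wlen[of l \<mu>] by (simp add: class_less_def)
  moreover have "wlen s \<noteq> 1"
  proof
    assume "wlen s = 1"
    then have "class_le r \<mu> ?\<nu>"
      using last(2) s by blast
    then show False
      using assms l(2) class_le_antisym unfolding class_less_def by blast
  qed
  ultimately show ?thesis
    using s by simp
qed

lemma adjacent_commute: "adjacent r \<mu> s t \<longleftrightarrow> adjacent r \<mu> t s"
proof -
  have "hat (inverse s * t) = hat (inverse t * s)"
    by (metis fgroup.inverse_distrib_swap fgroup.inverse_inverse hat_inverse)
  then show ?thesis
    by (auto simp: adjacent_def)
qed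

text \<open>A clique containing the unit lies in a ball, and balls are finite; so \<open>{1, s\<^sub>\<mu>}\<close> extends to a
  maximal clique.\<close>

lemma clique_of:
  assumes "\<mu> \<in> range hat"
  shows "maximal_clique r \<mu> (clique_of r \<mu>)" "1 \<in> clique_of r \<mu>" "class_min r \<mu> \<in> clique_of r \<mu>"
proof -
  let ?s = "class_min r \<mu>"
  define \<C> where "\<C> = {C. pairwise (adjacent r \<mu>) C \<and> {1, ?s} \<subseteq> C}"
  have "\<C> \<subseteq> Pow (word_ball (wlen ?s))"
  proof (rule subsetI, rule PowI, rule subsetI)
    fix C c
    assume "C \<in> \<C>" "c \<in> C"
    then have "adjacent r \<mu> 1 c" if "c \<noteq> 1"
      using that pairwiseD[of "adjacent r \<mu>" C 1 c] by (simp add: \<C>_def)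
    then show "c \<in> word_ball (wlen ?s)"
      using class_le_wlen[of c \<mu>] by (cases "c = 1") (auto simp: word_ball_def adjacent_def)
  qed
  then have "finite \<C>"
    using finite_subset finite_word_ball by blast
  moreover have "{1, ?s} \<in> \<C>"
    using hat_class_min[OF assms] class_le_refl
    by (auto simp: \<C>_def pairwise_def adjacent_def)
  ultimately obtain C where "C \<in> \<C>" "\<forall>C'\<in>\<C>. C \<subseteq> C' \<longrightarrow> C = C'"
    using finite_has_maximal[of \<C>] by blast
  then have "maximal_clique r \<mu> C \<and> {1, ?s} \<subseteq> C"
    unfolding maximal_clique_def \<C>_def by blast
  then have "maximal_clique r \<mu> (clique_of r \<mu>) \<and> {1, ?s} \<subseteq> clique_of r \<mu>"
    unfolding clique_of_def by (rule someI)
  then show "maximal_clique r \<mu> (clique_of r \<mu>)" "1 \<in> clique_of r \<mu>" "?s \<in> clique_of r \<mu>"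
    by auto
qed

lemma clique_of_diameter:
  assumes "\<mu> \<in> range hat" "c \<in> clique_of r \<mu>" "d \<in> clique_of r \<mu>"
  shows "wlen (inverse c * d) \<le> wlen (class_min r \<mu>)"
proof (cases "c = d")
  case False
  then have "adjacent r \<mu> c d"
    using assms clique_of(1)[OF assms(1)] by (auto simp: maximal_clique_def pairwise_def)
  then show ?thesis
    by (simp add: adjacent_def class_le_wlen)
qed (simp add: fgroup_left_inverse)

lemma mem_clique_ofI:
  assumes "\<mu> \<in> range hat"
    and "\<And>c. c \<in> clique_of r \<mu> \<Longrightarrow> wlen (inverse t * c) < wlen (class_min r \<mu>)"
  shows "t \<in> clique_of r \<mu>"
proof -
  have "adjacent r \<mu> t c" if "c \<in> clique_of r \<mu>" "c \<noteq> t" for c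
    using that assms class_le_shorter by (auto simp: adjacent_def)
  then have "pairwise (adjacent r \<mu>) (insert t (clique_of r \<mu>))"
    using clique_of(1)[OF assms(1)] adjacent_commute
    by (auto simp: maximal_clique_def pairwise_insert)
  then show ?thesis
    using clique_of(1)[OF assms(1)] unfolding maximal_clique_def by blast
qed

text \<open>A nontrivial word whose first letter differs from that of \<open>s\<^sub>\<mu>\<close> is further from \<open>s\<^sub>\<mu>\<close> than
  the unit is.\<close>

lemma clique_of_first_letter:
  assumes "\<mu> \<in> range hat" "class_min r \<mu> \<noteq> 1" "c \<in> clique_of r \<mu>" "c \<noteq> 1"
  shows "hd (word c) = hd (word (class_min r \<mu>))"
proof (rule ccontr)
  assume "hd (word c) \<noteq> hd (word (class_min r \<mu>))"
  then have "wlen (inverse (class_min r \<mu>) * c) = wlen (class_min r \<mu>) + wlen c"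
    using assms by (intro wlen_different_first_letters) auto
  then show False
    using clique_of_diameter[OF assms(1) clique_of(3)[OF assms(1)] assms(3)] assms(4) by simp
qed

lemma first_letter_in_clique_of:
  assumes "\<mu> \<in> range hat" "2 \<le> wlen (class_min r \<mu>)"
  shows "letter (hd (word (class_min r \<mu>))) \<in> clique_of r \<mu>"
proof (rule mem_clique_ofI[OF assms(1)])
  let ?x = "hd (word (class_min r \<mu>))"
  fix c
  assume c: "c \<in> clique_of r \<mu>"
  show "wlen (inverse (letter ?x) * c) < wlen (class_min r \<mu>)"
  proof (cases "c = 1")
    case True
    then show ?thesis
      using assms(2) by simp
  next
    case False
    have "hd (word c) = ?x"
      using assms c False by (intro clique_of_first_letter) auto
    then have "word c = ?x # tl (word c)"
      using False by (metis list.exhaust_sel word_eq_Nil_iff)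
    then obtain d where d: "c = letter ?x * d" "wlen c = Suc (wlen d)"
      by (rule word_ConsE)
    have "inverse (letter ?x) * c = d"
      using d(1) by (metis fgroup_left_inverse mult.assoc mult_1)
    moreover have "wlen c \<le> wlen (class_min r \<mu>)"
      using clique_of_diameter[OF assms(1) clique_of(2)[OF assms(1)] c] by simp
    ultimately show ?thesis
      using d(2) by simp
  qed
qed

text \<open>All elements of the clique other than the unit begin with the first letter \<open>t\<close> of \<open>s\<^sub>\<mu>\<close>.  Since
  \<open>t\<close> belongs to the clique, is not the unit, and is shorter than \<open>s\<^sub>\<mu>\<close>, it screens the unit from
  \<open>s\<^sub>\<mu>\<close>.\<close>

lemma gamma_quasi_multiplicative:
  fixes \<Phi> :: "'a fgroup \<Rightarrow> 'h::chilbert_space \<Rightarrow>\<^sub>L 'h"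
    and \<omega> :: "'a fgroup \<Rightarrow> 'h \<Rightarrow>\<^sub>L 'k::chilbert_space"
  assumes \<Phi>: "quasi_multiplicative \<Phi>"
    and \<mu>: "\<mu> \<in> range hat" "2 \<le> wlen (class_min r \<mu>)"
    and \<omega>: "realization (clique_of r \<mu>) (toeplitz \<Phi>) \<omega>"
    and x: "x \<in> D_space r \<mu> \<omega>"
  shows "gamma r \<mu> \<omega> x = 0"
proof -
  let ?C = "clique_of r \<mu>" and ?s = "class_min r \<mu>"
  define t where "t = letter (hd (word ?s))"
  have t: "t \<in> ?C" "wlen t = 1"
    unfolding t_def using \<mu> by (simp_all add: first_letter_in_clique_of)
  have distinct: "1 \<noteq> ?s" "t \<noteq> 1" "t \<noteq> ?s"
    using t(2) \<mu>(2) by auto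
  have screen: "toeplitz \<Phi> v 1 = toeplitz \<Phi> v t o\<^sub>L \<Phi> (inverse t)" if "v \<in> ?C - {1}" for v
  proof -
    have "hd (word v) = hd (word ?s)"
      using \<mu> that by (intro clique_of_first_letter) auto
    then have "word v = hd (word ?s) # tl (word v)"
      using that by (metis DiffD2 insertI1 list.exhaust_sel word_eq_Nil_iff)
    then obtain d where d: "v = t * d" "wlen v = Suc (wlen d)"
      unfolding t_def by (rule word_ConsE)
    have v: "inverse v * t = inverse d" "inverse v = inverse v * t * inverse t"
      using d(1) by (simp_all add: fgroup.inverse_distrib_swap mult.assoc fgroup_left_inverse)
    then have "wlen (inverse v * t * inverse t) = wlen (inverse v * t) + wlen (inverse t)"
      using d(2) t(2) by (metis add.commute plus_1_eq_Suc wlen_inverse)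
    then have "\<Phi> (inverse v * t * inverse t) = \<Phi> (inverse v * t) o\<^sub>L \<Phi> (inverse t)"
      by (rule quasi_multiplicative_times[OF \<Phi>])
    then show ?thesis
      using v(2) by (simp add: toeplitz_def)
  qed
  have "cinner x z = 0" if "z \<in> R_space r \<mu> \<omega>" for z
  proof (rule screened_defect_orthogonal[OF \<omega> clique_of(2,3)[OF \<mu>(1)] t(1) distinct screen])
    show "x \<in> realization_space \<omega> (?C - {?s}) \<ominus> realization_space \<omega> (?C - {1, ?s})"
      using x by (simp add: D_space_def Let_def)
    show "z \<in> realization_space \<omega> (?C - {1})"
      using that by (simp add: R_space_def Let_def orth_diff_def)
  qed
  moreover have "0 \<in> R_space r \<mu> \<omega>"
    by (simp add: R_space_def Let_def orth_diff_def zero_in_realization_space cinner_left.zero)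
  ultimately have "orth_proj (R_space r \<mu> \<omega>) x = 0"
    by (intro orth_proj_eq_0)
  then show ?thesis
    using x by (simp add: gamma_def)
qed

end

theorem theorem6p2:
  fixes r :: "'a::finite fgroup rel"
    and \<Phi> :: "'a fgroup \<Rightarrow> 'h::chilbert_space \<Rightarrow>\<^sub>L 'h"
  assumes "lexicographic r"
    and "quasi_multiplicative \<Phi>"
  shows "central_extension TYPE('k::chilbert_space) r 1 (restrict \<Phi> (word_ball 1)) \<Phi>"
  unfolding central_extension_def
proof (intro conjI ballI impI allI)
  show pd: "positive_definite_on UNIV \<Phi>"
    using assms(2) by (rule quasi_multiplicative_positive_definite)
  show "positive_definite_on (word_ball 1) (restrict \<Phi> (word_ball 1))"
    using pd by (rule positive_definite_on_restrict)
  show "restrict \<Phi> (word_ball 1) 1 = id_blinfun"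
    using assms(2) by (simp add: word_ball_def quasi_multiplicative_one)
  show "\<Phi> s = restrict \<Phi> (word_ball 1) s" if "s \<in> word_ball 1" for s
    using that by simp
next
  fix \<mu> :: "'a fgroup set" and \<omega> :: "'a fgroup \<Rightarrow> 'h \<Rightarrow>\<^sub>L 'k" and x
  assume \<mu>: "\<mu> \<in> range hat" "class_less r (last_class r 1) \<mu>"
    and "realization (clique_of r \<mu>) (toeplitz \<Phi>) \<omega>" "x \<in> D_space r \<mu> \<omega>"
  with class_after_letters[OF assms(1) \<mu>] show "gamma r \<mu> \<omega> x = 0"
    by (intro gamma_quasi_multiplicative[OF assms])
qed

end
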